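(* Let $X$ be a class of choice functions and let $\Lambda$ be a formal system whose axioms are all $X$-tautologies (i.e. $\mathsf{Ax}(\Lambda)\subseteq Taut(X)$) and whose inference rules are exactly Modus Ponens and the Generalization Rule. Then ${\rm RFOLS}(X,\Lambda)$ is sound: for every set $\Sigma$ of restricted sentences of $L_s$ and every restricted sentence $\varphi$ of $L_s$, if $\Sigma\vdash_\Lambda\varphi$ then $\Sigma\models^2_X\varphi$. In particular ${\rm RFOLS}(\mathcal F,\Lambda_0)$ is sound.
   Context: $L$ is a first-order language (logical symbols $\wedge,\neg,\forall,=$; other connectives and $\exists$ are abbreviations), $L_s=L\cup\{|\}$ with $|$ a new binary connective. For an $L$-structure $\mathcal M=\langle M,\dots\rangle$, $L(M)$ is $L$ with a new constant for each element of $M$. The basic formulas of $L_s(M)$ form the smallest set containing all formulas of $L(M)$ and closed under $\wedge,\vee,\rightarrow,\leftrightarrow,\neg,|$ (not under quantifiers); basic sentences are basic formulas with no free variables. The restricted formulas form the smallest set containing the basic formulas and closed under $\wedge,\vee,\rightarrow,\leftrightarrow,\neg,\forall,\exists$ (not under $|$); restricted sentences have no free variables. (The same definitions apply to $L_s$ itself.) A choice function for $\mathcal M$ is a map $f$ on unordered pairs of sentences of $L(M)$ with $f(\alpha,\beta)\in\{\alpha,\beta\}$, $f(\alpha,\alpha)=\alpha$. Its collapse $\overline f$ on basic sentences: $\overline f(\alpha)=\alpha$ for sentences $\alpha$ of $L(M)$, $\overline f(\varphi\wedge\psi)=\overline f(\varphi)\wedge\overline f(\psi)$, $\overline f(\neg\varphi)=\neg\overline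 f(\varphi)$, $\overline f(\varphi|\psi)=f(\overline f(\varphi),\overline f(\psi))$. Truth $\langle\mathcal M,f\rangle\models^2_s\varphi$ for restricted sentences of $L_s(M)$: for $\alpha$ a sentence of $L(M)$ iff $\mathcal M\models\alpha$; $\wedge$ and $\neg$ as usual; $\varphi|\psi$ iff $\mathcal M\models f(\overline f(\varphi),\overline f(\psi))$; $\forall v\varphi(v)$ iff $\langle\mathcal M,f\rangle\models^2_s\varphi(x)$ for every $x\in M$. $\mathcal F$ denotes the class of all choice functions (for all $L$-structures); a class $X$ of choice functions is a subclass of $\mathcal F$. $\Sigma\models^2_X\varphi$ means: for every $L$-structure $\mathcal M$ and every $f\in X$ for $\mathcal M$, if $\langle\mathcal M,f\rangle\models^2_s\sigma$ for all $\sigma\in\Sigma$ then $\langle\mathcal M,f\rangle\models^2_s\varphi$; $Taut(X)$ is the set of $\varphi$ with $\emptyset\models^2_X\varphi$. A formal system consists of axioms and inference rules over restricted formulas of $L_s$; $\Sigma\vdash_\Lambda\varphi$ is Hilbert-style provability in which all formulas are restricted. $\Lambda_0$ has as axioms all restricted instances of: the propositional schemes $\varphi\rightarrow(\psi\rightarrow\varphi)$, $(\varphi\rightarrow(\psi\rightarrow\sigma))\rightarrow((\varphi\rightarrow\psi)\rightarrow(\varphi\rightarrow\sigma))$, $(\neg\varphi\rightarrow\neg\psi)\rightarrow((\neg\varphi\rightarrow\psi)\rightarrow\varphi)$; universal instantiation $\forall v\varphi(v)\rightarrow\varphi(t)$ ($t$ closed); $\forall v(\varphi\rightarrow\psi(v))\rightarrow(\varphi\rightarrow\forall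 v\psi(v))$ ($v$ not free in $\varphi$); the equality axioms (reflexivity, symmetry, transitivity, substitution of equals in terms and in formulas); $S_1$: $\varphi\wedge\psi\rightarrow\varphi|\psi$; $S_2$: $\varphi|\psi\rightarrow\varphi\vee\psi$; $S_3$: $\varphi|\psi\rightarrow\psi|\varphi$; its rules are Modus Ponens and Generalization (from $\varphi$ infer $\forall v\varphi$). ${\rm RFOLS}(X,\Lambda)$ is the logic with semantic consequence $\models^2_X$ and provability $\vdash_\Lambda$.
   Formalization: The last claim fails for F if L has constants or function symbols (f may separate A(c) from A(x), x the value of c); it is proved for F if L has none, otherwise only for choice functions that treat sentences differing by closed terms of equal value as the same. *)

theory Defs
  imports Main "HOL-Library.Uprod"
begin

section \<open>First-order languages and formulas\<close>

text \<open>
  A language consists of the function symbols \<open>g\<close> with \<open>fun_ar g = Some n\<close> (constants are the case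
  \<open>n = 0\<close>) and the relation symbols \<open>r\<close> with \<open>rel_ar r = Some n\<close>; any of these sets may be empty.
\<close>

record ('f, 'r) language =
  fun_ar :: "'f \<Rightarrow> nat option"
  rel_ar :: "'r \<Rightarrow> nat option"

datatype 'f tm = Var nat | Fun 'f "'f tm list"

text \<open>Raw formulas of \<open>L\<^sub>s\<close>; \<open>Bar\<close> is the binary connective \<open>|\<close>.\<close>

datatype ('f, 'r) fm =
    Eq "'f tm" "'f tm"
  | Rel 'r "'f tm list"
  | Neg "('f, 'r) fm"
  | And "('f, 'r) fm" "('f, 'r) fm"
  | Forall nat "('f, 'r) fm"
  | Bar "('f, 'r) fm" "('f, 'r) fm"

abbreviation Imp :: "('f, 'r) fm \<Rightarrow> ('f, 'r) fm \<Rightarrow> ('f, 'r) fm" where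
  "Imp \<phi> \<psi> \<equiv> Neg (And \<phi> (Neg \<psi>))"

abbreviation Or :: "('f, 'r) fm \<Rightarrow> ('f, 'r) fm \<Rightarrow> ('f, 'r) fm" where
  "Or \<phi> \<psi> \<equiv> Neg (And (Neg \<phi>) (Neg \<psi>))"

fun wf_tm :: "('f, 'r) language \<Rightarrow> 'f tm \<Rightarrow> bool" where
  "wf_tm L (Var v) = True"
| "wf_tm L (Fun g ts) = (fun_ar L g = Some (length ts) \<and> (\<forall>t\<in>set ts. wf_tm L t))"

primrec formula :: "('f, 'r) language \<Rightarrow> ('f, 'r) fm \<Rightarrow> bool" where
  "formula L (Eq s t) = (wf_tm L s \<and> wf_tm L t)"
| "formula L (Rel r ts) = (rel_ar L r = Some (length ts) \<and> (\<forall>t\<in>set ts. wf_tm L t))"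
| "formula L (Neg \<phi>) = formula L \<phi>"
| "formula L (And \<phi> \<psi>) = (formula L \<phi> \<and> formula L \<psi>)"
| "formula L (Forall v \<phi>) = formula L \<phi>"
| "formula L (Bar \<phi> \<psi>) = False"

fun fv_tm :: "'f tm \<Rightarrow> nat set" where
  "fv_tm (Var v) = {v}"
| "fv_tm (Fun g ts) = (\<Union>t\<in>set ts. fv_tm t)"

primrec fv :: "('f, 'r) fm \<Rightarrow> nat set" where
  "fv (Eq s t) = fv_tm s \<union> fv_tm t"
| "fv (Rel r ts) = (\<Union>t\<in>set ts. fv_tm t)"
| "fv (Neg \<phi>) = fv \<phi>"
| "fv (And \<phi> \<psi>) = fv \<phi> \<union> fv \<psi>"
| "fv (Forall v \<phi>) = fv \<phi> - {v}"
| "fv (Bar \<phi> \<psi>) = fv \<phi> \<union> fv \<psi>"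

text \<open>
  The closure conditions are stated for the primitive connectives only: \<open>\<or>\<close>, \<open>\<rightarrow>\<close>, \<open>\<leftrightarrow>\<close>, \<open>\<exists>\<close> abbreviate
  combinations of \<open>\<and>\<close>, \<open>\<not>\<close>, \<open>\<forall>\<close>.
\<close>

inductive basic :: "('f, 'r) language \<Rightarrow> ('f, 'r) fm \<Rightarrow> bool" for L where
  "formula L \<phi> \<Longrightarrow> basic L \<phi>"
| "basic L \<phi> \<Longrightarrow> basic L (Neg \<phi>)"
| "basic L \<phi> \<Longrightarrow> basic L \<psi> \<Longrightarrow> basic L (And \<phi> \<psi>)"
| "basic L \<phi> \<Longrightarrow> basic L \<psi> \<Longrightarrow> basic L (Bar \<phi> \<psi>)"

inductive restricted :: "('f, 'r) language \<Rightarrow> ('f, 'r) fm \<Rightarrow> bool" for L where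
  "basic L \<phi> \<Longrightarrow> restricted L \<phi>"
| "restricted L \<phi> \<Longrightarrow> restricted L (Neg \<phi>)"
| "restricted L \<phi> \<Longrightarrow> restricted L \<psi> \<Longrightarrow> restricted L (And \<phi> \<psi>)"
| "restricted L \<phi> \<Longrightarrow> restricted L (Forall v \<phi>)"

definition sentence :: "('f, 'r) language \<Rightarrow> ('f, 'r) fm \<Rightarrow> bool" where
  "sentence L \<alpha> \<longleftrightarrow> formula L \<alpha> \<and> fv \<alpha> = {}"

definition restricted_sentence :: "('f, 'r) language \<Rightarrow> ('f, 'r) fm \<Rightarrow> bool" where
  "restricted_sentence L \<phi> \<longleftrightarrow> restricted L \<phi> \<and> fv \<phi> = {}"

text \<open>
  Simultaneous substitution for the free variables. Bound variables are not renamed; it is used only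
  where no variable is captured.
\<close>

primrec subst_tm :: "(nat \<Rightarrow> 'f tm) \<Rightarrow> 'f tm \<Rightarrow> 'f tm" where
  "subst_tm \<sigma> (Var v) = \<sigma> v"
| "subst_tm \<sigma> (Fun g ts) = Fun g (map (subst_tm \<sigma>) ts)"

primrec subst :: "(nat \<Rightarrow> 'f tm) \<Rightarrow> ('f, 'r) fm \<Rightarrow> ('f, 'r) fm" where
  "subst \<sigma> (Eq s t) = Eq (subst_tm \<sigma> s) (subst_tm \<sigma> t)"
| "subst \<sigma> (Rel r ts) = Rel r (map (subst_tm \<sigma>) ts)"
| "subst \<sigma> (Neg \<phi>) = Neg (subst \<sigma> \<phi>)"
| "subst \<sigma> (And \<phi> \<psi>) = And (subst \<sigma> \<phi>) (subst \<sigma> \<psi>)"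
| "subst \<sigma> (Forall v \<phi>) = Forall v (subst (\<sigma>(v := Var v)) \<phi>)"
| "subst \<sigma> (Bar \<phi> \<psi>) = Bar (subst \<sigma> \<phi>) (subst \<sigma> \<psi>)"

abbreviation subst1 :: "nat \<Rightarrow> 'f tm \<Rightarrow> ('f, 'r) fm \<Rightarrow> ('f, 'r) fm" where
  "subst1 v t \<equiv> subst (Var(v := t))"

text \<open>\<open>free_for t v \<phi>\<close>: no variable of \<open>t\<close> is captured when \<open>t\<close> replaces \<open>v\<close> in \<open>\<phi>\<close>.\<close>

primrec free_for :: "'f tm \<Rightarrow> nat \<Rightarrow> ('f, 'r) fm \<Rightarrow> bool" where
  "free_for t v (Eq s s') = True"
| "free_for t v (Rel r ts) = True"
| "free_for t v (Neg \<phi>) = free_for t v \<phi>"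
| "free_for t v (And \<phi> \<psi>) = (free_for t v \<phi> \<and> free_for t v \<psi>)"
| "free_for t v (Forall w \<phi>) = (v \<notin> fv (Forall w \<phi>) \<or> w \<notin> fv_tm t \<and> free_for t v \<phi>)"
| "free_for t v (Bar \<phi> \<psi>) = (free_for t v \<phi> \<and> free_for t v \<psi>)"


section \<open>Structures and the language \<open>L(M)\<close>\<close>

record ('f, 'r, 'm) fo_struct =
  Dom :: "'m set"
  fint :: "'f \<Rightarrow> 'm list \<Rightarrow> 'm"
  rint :: "'r \<Rightarrow> 'm list \<Rightarrow> bool"

definition is_struct :: "('f, 'r) language \<Rightarrow> ('f, 'r, 'm) fo_struct \<Rightarrow> bool" where
  "is_struct L M \<longleftrightarrow> Dom M \<noteq> {} \<and>
     (\<forall>g xs. fun_ar L g = Some (length xs) \<and> set xs \<subseteq> Dom M \<longrightarrow> fint M g xs \<in> Dom M)"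

datatype ('f, 'm) esym = Symb 'f | Name 'm

definition lang_of ::
  "('f, 'r) language \<Rightarrow> ('f, 'r, 'm) fo_struct \<Rightarrow> (('f, 'm) esym, 'r) language" where
  "lang_of L M =
     \<lparr>fun_ar = (\<lambda>s. case s of Symb g \<Rightarrow> fun_ar L g | Name x \<Rightarrow> if x \<in> Dom M then Some 0 else None),
      rel_ar = rel_ar L\<rparr>"

type_synonym ('f, 'r, 'm) efm = "(('f, 'm) esym, 'r) fm"

abbreviation name :: "'m \<Rightarrow> ('f, 'm) esym tm" where
  "name x \<equiv> Fun (Name x) []"

abbreviation embed :: "('f, 'r) fm \<Rightarrow> ('f, 'r, 'm) efm" where
  "embed \<equiv> map_fm Symb (\<lambda>r. r)"

text \<open>Value of a closed term of \<open>L(M)\<close>; the first clause is irrelevant.\<close>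

primrec esym_int :: "('f, 'r, 'm) fo_struct \<Rightarrow> ('f, 'm) esym \<Rightarrow> 'm list \<Rightarrow> 'm" where
  "esym_int M (Symb g) xs = fint M g xs"
| "esym_int M (Name x) xs = x"

primrec val :: "('f, 'r, 'm) fo_struct \<Rightarrow> ('f, 'm) esym tm \<Rightarrow> 'm" where
  "val M (Var v) = undefined"
| "val M (Fun s ts) = esym_int M s (map (val M) ts)"

primrec height :: "('f, 'r) fm \<Rightarrow> nat" where
  "height (Eq s t) = 0"
| "height (Rel r ts) = 0"
| "height (Neg \<phi>) = Suc (height \<phi>)"
| "height (And \<phi> \<psi>) = Suc (height \<phi> + height \<psi>)"
| "height (Forall v \<phi>) = Suc (height \<phi>)"
| "height (Bar \<phi> \<psi>) = Suc (height \<phi> + height \<psi>)"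

lemma height_subst [simp]: "height (subst \<sigma> \<phi>) = height \<phi>"
  by (induction \<phi> arbitrary: \<sigma>) auto

text \<open>
  Truth \<open>M \<Turnstile> \<alpha>\<close> of a sentence \<open>\<alpha>\<close> of \<open>L(M)\<close>. The last clause is irrelevant, as \<open>Bar\<close> does not occur in
  such sentences.
\<close>

function holds :: "('f, 'r, 'm) fo_struct \<Rightarrow> ('f, 'r, 'm) efm \<Rightarrow> bool" where
  "holds M (Eq s t) = (val M s = val M t)"
| "holds M (Rel r ts) = rint M r (map (val M) ts)"
| "holds M (Neg \<phi>) = (\<not> holds M \<phi>)"
| "holds M (And \<phi> \<psi>) = (holds M \<phi> \<and> holds M \<psi>)"
| "holds M (Forall v \<phi>) = (\<forall>x\<in>Dom M. holds M (subst1 v (name x) \<phi>))"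
| "holds M (Bar \<phi> \<psi>) = False"
  by pat_completeness auto
termination by (relation "measure (\<lambda>(M, \<phi>). height \<phi>)") auto


section \<open>Choice functions and the semantics of superposition\<close>

text \<open>
  The type \<open>uprod\<close> consists of the unordered pairs \<open>Upair \<alpha> \<beta>\<close>, including \<open>Upair \<alpha> \<alpha>\<close>; the requirement
  \<open>f(\<alpha>, \<alpha>) = \<alpha>\<close> is the case \<open>\<alpha> = \<beta>\<close> of the definition below.
\<close>

type_synonym ('f, 'r, 'm) choice = "('f, 'r, 'm) efm uprod \<Rightarrow> ('f, 'r, 'm) efm"

definition choice_fun ::
  "('f, 'r) language \<Rightarrow> ('f, 'r, 'm) fo_struct \<Rightarrow> ('f, 'r, 'm) choice \<Rightarrow> bool" where
  "choice_fun L M f \<longleftrightarrow>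
     (\<forall>\<alpha> \<beta>. sentence (lang_of L M) \<alpha> \<and> sentence (lang_of L M) \<beta> \<longrightarrow> f (Upair \<alpha> \<beta>) \<in> {\<alpha>, \<beta>})"

text \<open>
  The collapse is meant for basic sentences of \<open>L\<^sub>s(M)\<close>, where a quantifier can only stand in front of a
  formula of \<open>L(M)\<close>.
\<close>

primrec collapse :: "('f, 'r, 'm) choice \<Rightarrow> ('f, 'r, 'm) efm \<Rightarrow> ('f, 'r, 'm) efm" where
  "collapse f (Eq s t) = Eq s t"
| "collapse f (Rel r ts) = Rel r ts"
| "collapse f (Neg \<phi>) = Neg (collapse f \<phi>)"
| "collapse f (And \<phi> \<psi>) = And (collapse f \<phi>) (collapse f \<psi>)"
| "collapse f (Forall v \<phi>) = Forall v \<phi>"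
| "collapse f (Bar \<phi> \<psi>) = f (Upair (collapse f \<phi>) (collapse f \<psi>))"

lemma collapse_formula: "formula L \<alpha> \<Longrightarrow> collapse f \<alpha> = \<alpha>"
  by (induction \<alpha>) auto

text \<open>Truth \<open>\<langle>M, f\<rangle> \<Turnstile> \<phi>\<close> of a restricted sentence \<open>\<phi>\<close> of \<open>L\<^sub>s(M)\<close>.\<close>

function truth :: "('f, 'r, 'm) fo_struct \<Rightarrow> ('f, 'r, 'm) choice \<Rightarrow> ('f, 'r, 'm) efm \<Rightarrow> bool" where
  "truth M f (Eq s t) = holds M (Eq s t)"
| "truth M f (Rel r ts) = holds M (Rel r ts)"
| "truth M f (Neg \<phi>) = (\<not> truth M f \<phi>)"
| "truth M f (And \<phi> \<psi>) = (truth M f \<phi> \<and> truth M f \<psi>)"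
| "truth M f (Bar \<phi> \<psi>) = holds M (f (Upair (collapse f \<phi>) (collapse f \<psi>)))"
| "truth M f (Forall v \<phi>) = (\<forall>x\<in>Dom M. truth M f (subst1 v (name x) \<phi>))"
  by pat_completeness auto
termination by (relation "measure (\<lambda>(M, f, \<phi>). height \<phi>)") auto

primrec bar_free :: "('f, 'r) fm \<Rightarrow> bool" where
  "bar_free (Eq s t) = True"
| "bar_free (Rel r ts) = True"
| "bar_free (Neg \<phi>) = bar_free \<phi>"
| "bar_free (And \<phi> \<psi>) = (bar_free \<phi> \<and> bar_free \<psi>)"
| "bar_free (Forall v \<phi>) = bar_free \<phi>"
| "bar_free (Bar \<phi> \<psi>) = False"

lemma formula_bar_free: "formula L \<phi> \<Longrightarrow> bar_free \<phi>"
  by (induction \<phi>) auto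

lemma bar_free_subst [simp]: "bar_free (subst \<sigma> \<phi>) = bar_free \<phi>"
  by (induction \<phi> arbitrary: \<sigma>) auto

lemma truth_bar_free: "bar_free \<alpha> \<Longrightarrow> truth M f \<alpha> = holds M \<alpha>"
  by (induction M f \<alpha> rule: truth.induct) auto

lemma truth_formula: "formula (lang_of L M) \<alpha> \<Longrightarrow> truth M f \<alpha> = holds M \<alpha>"
  using formula_bar_free truth_bar_free by blast

text \<open>
  The formulas of \<open>L\<^sub>s\<close> occurring in derivations may have free variables. As usual such a formula is
  true if all its instances by elements of the domain are true, that is, if its universal closure is.
  For sentences the substitution is vacuous.
\<close>

definition models ::
  "('f, 'r, 'm) fo_struct \<Rightarrow> ('f, 'r, 'm) choice \<Rightarrow> ('f, 'r) fm \<Rightarrow> bool" where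
  "models M f \<phi> \<longleftrightarrow>
     (\<forall>e. range e \<subseteq> Dom M \<longrightarrow> truth M f (subst (\<lambda>v. name (e v)) (embed \<phi>)))"

lemma subst_tm_id: "\<forall>v\<in>fv_tm t. \<sigma> v = Var v \<Longrightarrow> subst_tm \<sigma> t = t"
  by (induction t) (auto intro: map_idI)

lemma subst_id: "\<forall>v\<in>fv \<phi>. \<sigma> v = Var v \<Longrightarrow> subst \<sigma> \<phi> = \<phi>"
  by (induction \<phi> arbitrary: \<sigma>) (auto intro!: map_idI subst_tm_id)

lemma fv_tm_map [simp]: "fv_tm (map_tm h t) = fv_tm t"
  by (induction t) auto

lemma fv_map [simp]: "fv (map_fm h k \<phi>) = fv \<phi>"
  by (induction \<phi>) auto

lemma models_sentence:
  assumes "fv \<phi> = {}" "Dom M \<noteq> {}"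
  shows "models M f \<phi> \<longleftrightarrow> truth M f (embed \<phi>)"
proof -
  have "subst \<sigma> (embed \<phi>) = embed \<phi>" for \<sigma>
    using assms(1) by (intro subst_id) auto
  moreover from assms(2) obtain x where "x \<in> Dom M" by blast
  then have "range (\<lambda>_ :: nat. x) \<subseteq> Dom M" by auto
  ultimately show ?thesis
    unfolding models_def by metis
qed

text \<open>
  A class of choice functions is a set of pairs \<open>(M, f)\<close>, meaning that it contains \<open>f\<close> as a choice
  function for \<open>M\<close>. The domains of the structures are the nonempty subsets of the arbitrary type \<open>'m\<close>.
\<close>

definition all_choice ::
  "('f, 'r) language \<Rightarrow> (('f, 'r, 'm) fo_struct \<times> ('f, 'r, 'm) choice) set" where
  "all_choice L = {(M, f). is_struct L M \<and> choice_fun L M f}"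

definition entails ::
  "(('f, 'r, 'm) fo_struct \<times> ('f, 'r, 'm) choice) set \<Rightarrow> ('f, 'r) fm set \<Rightarrow> ('f, 'r) fm \<Rightarrow> bool" where
  "entails X \<Sigma> \<phi> \<longleftrightarrow> (\<forall>(M, f)\<in>X. (\<forall>\<sigma>\<in>\<Sigma>. models M f \<sigma>) \<longrightarrow> models M f \<phi>)"

definition Taut ::
  "('f, 'r) language \<Rightarrow> (('f, 'r, 'm) fo_struct \<times> ('f, 'r, 'm) choice) set \<Rightarrow> ('f, 'r) fm set" where
  "Taut L X = {\<phi>. restricted L \<phi> \<and> entails X {} \<phi>}"


section \<open>Formal systems\<close>

text \<open>An inference rule is the set of its instances (list of premises, conclusion).\<close>

type_synonym ('f, 'r) rule = "(('f, 'r) fm list \<times> ('f, 'r) fm) set"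

record ('f, 'r) formal_system =
  Ax :: "('f, 'r) fm set"
  IR :: "('f, 'r) rule set"

definition MP :: "('f, 'r) rule" where
  "MP = {([\<phi>, Imp \<phi> \<psi>], \<psi>) | \<phi> \<psi>. True}"

definition GR :: "('f, 'r) rule" where
  "GR = {([\<phi>], Forall v \<phi>) | v \<phi>. True}"

inductive provable ::
  "('f, 'r) language \<Rightarrow> ('f, 'r) formal_system \<Rightarrow> ('f, 'r) fm set \<Rightarrow> ('f, 'r) fm \<Rightarrow> bool"
  for L \<Lambda> \<Sigma> where
  "\<phi> \<in> Ax \<Lambda> \<Longrightarrow> restricted L \<phi> \<Longrightarrow> provable L \<Lambda> \<Sigma> \<phi>"
| "\<phi> \<in> \<Sigma> \<Longrightarrow> restricted L \<phi> \<Longrightarrow> provable L \<Lambda> \<Sigma> \<phi>"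
| "R \<in> IR \<Lambda> \<Longrightarrow> (ps, \<phi>) \<in> R \<Longrightarrow> (\<And>\<psi>. \<psi> \<in> set ps \<Longrightarrow> provable L \<Lambda> \<Sigma> \<psi>) \<Longrightarrow> restricted L \<phi> \<Longrightarrow>
     provable L \<Lambda> \<Sigma> \<phi>"

definition sound ::
  "('f, 'r) language \<Rightarrow> (('f, 'r, 'm) fo_struct \<times> ('f, 'r, 'm) choice) set \<Rightarrow>
    ('f, 'r) formal_system \<Rightarrow> bool" where
  "sound L X \<Lambda> \<longleftrightarrow>
     (\<forall>\<Sigma> \<phi>. (\<forall>\<sigma>\<in>\<Sigma>. restricted_sentence L \<sigma>) \<and> restricted_sentence L \<phi> \<and> provable L \<Lambda> \<Sigma> \<phi> \<longrightarrow>
       entails X \<Sigma> \<phi>)"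

inductive_set schemes :: "('f, 'r) fm set" where
  P1: "Imp \<phi> (Imp \<psi> \<phi>) \<in> schemes"
| P2: "Imp (Imp \<phi> (Imp \<psi> \<sigma>)) (Imp (Imp \<phi> \<psi>) (Imp \<phi> \<sigma>)) \<in> schemes"
| P3: "Imp (Imp (Neg \<phi>) (Neg \<psi>)) (Imp (Imp (Neg \<phi>) \<psi>) \<phi>) \<in> schemes"
| UI: "fv_tm t = {} \<Longrightarrow> Imp (Forall v \<phi>) (subst1 v t \<phi>) \<in> schemes"
| D: "v \<notin> fv \<phi> \<Longrightarrow> Imp (Forall v (Imp \<phi> \<psi>)) (Imp \<phi> (Forall v \<psi>)) \<in> schemes"
| E_refl: "Eq t t \<in> schemes"
| E_sym: "Imp (Eq t s) (Eq s t) \<in> schemes"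
| E_trans: "Imp (Eq t s) (Imp (Eq s u) (Eq t u)) \<in> schemes"
| E_term: "Imp (Eq t s) (Eq (subst_tm (Var(v := t)) u) (subst_tm (Var(v := s)) u)) \<in> schemes"
| E_fm: "free_for t v \<phi> \<Longrightarrow> free_for s v \<phi> \<Longrightarrow>
     Imp (Eq t s) (Imp (subst1 v t \<phi>) (subst1 v s \<phi>)) \<in> schemes"
| S1: "Imp (And \<phi> \<psi>) (Bar \<phi> \<psi>) \<in> schemes"
| S2: "Imp (Bar \<phi> \<psi>) (Or \<phi> \<psi>) \<in> schemes"
| S3: "Imp (Bar \<phi> \<psi>) (Bar \<psi> \<phi>) \<in> schemes"

definition Lambda0 :: "('f, 'r) language \<Rightarrow> ('f, 'r) formal_system" where
  "Lambda0 L = \<lparr>Ax = {\<phi> \<in> schemes. restricted L \<phi>}, IR = {MP, GR}\<rparr>"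


section \<open>Identifying closed terms with their values\<close>

text \<open>
  Universal instantiation passes from \<open>\<phi>(x)\<close> for all \<open>x \<in> M\<close> to \<open>\<phi>(t)\<close> for a closed term \<open>t\<close>. This tacitly
  identifies a closed term of \<open>L(M)\<close> with the name of its value. If \<open>L\<close> has a constant \<open>c\<close>, then
  \<open>\<phi>(c)\<close> and \<open>\<phi>(x)\<close>, where \<open>x\<close> is the value of \<open>c\<close>, are different sentences of \<open>L(M)\<close>, between
  which an arbitrary choice function may distinguish, and \<open>\<Lambda>\<^sub>0\<close> fails to be sound (see
  \<open>Lambda0_not_sound\<close> below). The identification is made for the choice functions in \<open>ident_choice L\<close>:
  sentences that agree after every closed term has been replaced by the name of its value count as the
  same sentence. Without function symbols in \<open>L\<close>, every choice function is of this kind (see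
  \<open>ident_choice_relational\<close>).
\<close>

primrec eval_closed_tm :: "('f, 'r, 'm) fo_struct \<Rightarrow> ('f, 'm) esym tm \<Rightarrow> ('f, 'm) esym tm" where
  "eval_closed_tm M (Var v) = Var v"
| "eval_closed_tm M (Fun s ts) =
     (if fv_tm (Fun s ts) = {} then name (val M (Fun s ts)) else Fun s (map (eval_closed_tm M) ts))"

primrec eval_closed :: "('f, 'r, 'm) fo_struct \<Rightarrow> ('f, 'r, 'm) efm \<Rightarrow> ('f, 'r, 'm) efm" where
  "eval_closed M (Eq s t) = Eq (eval_closed_tm M s) (eval_closed_tm M t)"
| "eval_closed M (Rel r ts) = Rel r (map (eval_closed_tm M) ts)"
| "eval_closed M (Neg \<phi>) = Neg (eval_closed M \<phi>)"
| "eval_closed M (And \<phi> \<psi>) = And (eval_closed M \<phi>) (eval_closed M \<psi>)"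
| "eval_closed M (Forall v \<phi>) = Forall v (eval_closed M \<phi>)"
| "eval_closed M (Bar \<phi> \<psi>) = Bar (eval_closed M \<phi>) (eval_closed M \<psi>)"

definition same_sentence ::
  "('f, 'r, 'm) fo_struct \<Rightarrow> ('f, 'r, 'm) efm \<Rightarrow> ('f, 'r, 'm) efm \<Rightarrow> bool" where
  "same_sentence M \<alpha> \<beta> \<longleftrightarrow> eval_closed M \<alpha> = eval_closed M \<beta>"

definition ident_choice ::
  "('f, 'r) language \<Rightarrow> (('f, 'r, 'm) fo_struct \<times> ('f, 'r, 'm) choice) set" where
  "ident_choice L = {(M, f) \<in> all_choice L.
     \<forall>\<alpha> \<alpha>' \<beta> \<beta>'. sentence (lang_of L M) \<alpha> \<and> sentence (lang_of L M) \<alpha>' \<and>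
        sentence (lang_of L M) \<beta> \<and> sentence (lang_of L M) \<beta>' \<and>
        same_sentence M \<alpha> \<alpha>' \<and> same_sentence M \<beta> \<beta>' \<longrightarrow>
        same_sentence M (f (Upair \<alpha> \<beta>)) (f (Upair \<alpha>' \<beta>'))}"

lemma eval_closed_tm_relational:
  assumes "\<forall>g. fun_ar L g = None" "wf_tm (lang_of L M) t"
  shows "eval_closed_tm M t = t"
proof (cases t)
  case (Fun s ts)
  with assms show ?thesis by (cases s) (auto simp: lang_of_def split: if_splits)
qed auto

lemma eval_closed_relational:
  assumes "\<forall>g. fun_ar L g = None" "formula (lang_of L M) \<phi>"
  shows "eval_closed M \<phi> = \<phi>"
  using assms(2)
  by (induction \<phi>) (auto intro!: map_idI eval_closed_tm_relational[OF assms(1)])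

lemma ident_choice_relational:
  assumes "\<forall>g. fun_ar L g = None"
  shows "ident_choice L = all_choice L"
  using assms
  by (auto simp: ident_choice_def same_sentence_def sentence_def eval_closed_relational)

lemma Lambda0_not_sound:
  assumes c: "fun_ar L c = Some 0"
  shows "\<not> sound L (all_choice L :: (('f, 'r, 'm) fo_struct \<times> ('f, 'r, 'm) choice) set) (Lambda0 L)"
proof
  let ?X = "all_choice L :: (('f, 'r, 'm) fo_struct \<times> ('f, 'r, 'm) choice) set"
  assume snd: "sound L ?X (Lambda0 L)"
  define B :: "('f, 'r) fm" where "B = Neg (Forall 0 (Eq (Var 0) (Var 0)))"
  define \<phi> :: "('f, 'r) fm" where "\<phi> = Bar (Eq (Var 0) (Var 0)) B"
  define \<theta> where "\<theta> = Imp (Forall 0 \<phi>) (subst1 0 (Fun c []) \<phi>)"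
  define B' :: "('f, 'r, 'm) efm" where "B' = embed B"
  define C' :: "('f, 'r, 'm) efm" where "C' = Eq (Fun (Symb c) []) (Fun (Symb c) [])"
  define f :: "('f, 'r, 'm) choice" where
    "f = (\<lambda>p. if p = Upair C' B' then B' else if \<exists>\<alpha>. p = Upair \<alpha> B' then SOME \<alpha>. p = Upair \<alpha> B'
              else SOME \<alpha>. \<alpha> \<in> set_uprod p)"
  define M :: "('f, 'r, 'm) fo_struct" where
    "M = \<lparr>Dom = {undefined}, fint = (\<lambda>_ _. undefined), rint = (\<lambda>_ _. True)\<rparr>"
  have f_in: "f (Upair \<alpha> \<beta>) \<in> {\<alpha>, \<beta>}" for \<alpha> \<beta>
  proof -
    consider "Upair \<alpha> \<beta> = Upair C' B'"
      | "Upair \<alpha> \<beta> \<noteq> Upair C' B'" "\<exists>\<gamma>. Upair \<alpha> \<beta> = Upair \<gamma> B'"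
      | "Upair \<alpha> \<beta> \<noteq> Upair C' B'" "\<not> (\<exists>\<gamma>. Upair \<alpha> \<beta> = Upair \<gamma> B')"
      by blast
    then show ?thesis
    proof cases
      case 1
      then show ?thesis by (auto simp: f_def)
    next
      case 2
      have "Upair \<alpha> \<beta> = Upair (SOME \<gamma>. Upair \<alpha> \<beta> = Upair \<gamma> B') B'"
        using someI_ex[OF 2(2)] .
      moreover have "f (Upair \<alpha> \<beta>) = (SOME \<gamma>. Upair \<alpha> \<beta> = Upair \<gamma> B')"
        unfolding f_def using 2 by presburger
      ultimately have "Upair \<alpha> \<beta> = Upair (f (Upair \<alpha> \<beta>)) B'" by presburger
      then show ?thesis unfolding Upair_inject by auto
    next
      case 3
      have "f (Upair \<alpha> \<beta>) = (SOME \<gamma>. \<gamma> \<in> set_uprod (Upair \<alpha> \<beta>))"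
        unfolding f_def using 3 by presburger
      moreover have "(SOME \<gamma>. \<gamma> \<in> set_uprod (Upair \<alpha> \<beta>)) \<in> set_uprod (Upair \<alpha> \<beta>)"
        by (rule someI[of _ \<alpha>]) simp
      ultimately show ?thesis by simp
    qed
  qed
  have X: "(M, f) \<in> ?X"
    using f_in by (auto simp: all_choice_def is_struct_def choice_fun_def M_def)
  have bB: "basic L B" by (simp add: B_def basic.intros(1))
  have "basic L \<phi>" unfolding \<phi>_def by (intro basic.intros(4) bB) (simp add: basic.intros(1))
  moreover have "subst1 0 (Fun c []) \<phi> = Bar (Eq (Fun c []) (Fun c [])) B"
    by (simp add: \<phi>_def B_def)
  then have "basic L (subst1 0 (Fun c []) \<phi>)"
    using c by (auto intro!: basic.intros(4) bB intro: basic.intros(1))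
  ultimately have "restricted L \<theta>" unfolding \<theta>_def
    by (intro restricted.intros(2-4)) (auto intro: restricted.intros(1))
  then have R: "restricted_sentence L \<theta>"
    by (simp add: restricted_sentence_def \<theta>_def \<phi>_def B_def)
  have "\<theta> \<in> schemes" unfolding \<theta>_def by (rule schemes.UI) simp
  with R have "\<theta> \<in> Ax (Lambda0 L)"
    by (simp add: Lambda0_def restricted_sentence_def)
  with R have "provable L (Lambda0 L) {} \<theta>"
    by (auto simp: restricted_sentence_def intro: provable.intros)
  with snd R have "entails ?X {} \<theta>" by (auto simp: sound_def)
  with X have "models M f \<theta>" by (auto simp: entails_def)
  moreover have "fv \<theta> = {}" using R by (simp add: restricted_sentence_def)
  moreover have "Dom M \<noteq> {}" by (simp add: M_def)
  ultimately have "truth M f (embed \<theta>)" by (simp add: models_sentence)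
  moreover define N' :: "('f, 'r, 'm) efm" where "N' = Eq (name undefined) (name undefined)"
  have collB: "collapse f B' = B'" by (simp add: B'_def B_def)
  have "f (Upair C' B') = B'" by (simp add: f_def)
  then have "\<not> truth M f (Bar C' B')"
    using collB by (simp add: C'_def) (simp add: B'_def B_def)
  then have "\<not> truth M f (embed (subst1 0 (Fun c []) \<phi>))"
    by (simp add: \<phi>_def B_def B'_def C'_def)
  moreover have "truth M f (embed (Forall 0 \<phi>))"
  proof -
    have ne: "Upair N' B' \<noteq> Upair C' B'" "N' \<noteq> B'"
      by (auto simp: Upair_inject N'_def C'_def B'_def B_def)
    have ex: "\<exists>\<alpha>. Upair N' B' = Upair \<alpha> B'" by blast
    have "Upair N' B' = Upair (SOME \<gamma>. Upair N' B' = Upair \<gamma> B') B'"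
      using someI_ex[OF ex] .
    moreover have "f (Upair N' B') = (SOME \<gamma>. Upair N' B' = Upair \<gamma> B')"
      unfolding f_def using ne(1) ex by presburger
    ultimately have "Upair N' B' = Upair (f (Upair N' B')) B'" by presburger
    then have "f (Upair N' B') = N'" using ne(2) unfolding Upair_inject by auto
    then have "truth M f (Bar N' B')"
      using collB by (simp add: N'_def)
    then show ?thesis by (simp add: \<phi>_def M_def N'_def B'_def B_def)
  qed
  ultimately show False by (simp add: \<theta>_def)
qed

end

theory Submission
  imports Defs
begin

text \<open>
  Validity under all assignments is preserved by the two rules, which gives soundness for every
  class \<open>X\<close>. Among the axioms of \<open>\<Lambda>\<^sub>0\<close> the delicate ones are universal instantiation and substitution
  of equals: both compare a sentence \<open>\<phi>(t)\<close> with \<open>\<phi>(s)\<close>, where \<open>t\<close> and \<open>s\<close> are closed terms of the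
  same value. Such sentences agree after evaluation of all closed terms, and for choice functions that
  respect this identification the truth value of a sentence depends only on its evaluated form.
\<close>

section \<open>Basic and restricted formulas\<close>

text \<open>The inductive clauses overlap: a negation or conjunction of formulas of the language is
  already basic by the first clause. These equations follow the outermost symbol instead, so that
  later inductions can run over the structure of \<open>fm\<close>.\<close>

lemma basic_simps [simp]:
  "basic K (Eq s t) \<longleftrightarrow> formula K (Eq s t)"
  "basic K (Rel r ts) \<longleftrightarrow> formula K (Rel r ts)"
  "basic K (Neg \<phi>) \<longleftrightarrow> basic K \<phi>"
  "basic K (And \<phi> \<psi>) \<longleftrightarrow> basic K \<phi> \<and> basic K \<psi>"
  "basic K (Forall v \<phi>) \<longleftrightarrow> formula K \<phi>"
  "basic K (Bar \<phi> \<psi>) \<longleftrightarrow> basic K \<phi> \<and> basic K \<psi>"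
  by (subst basic.simps; auto intro: basic.intros)+

lemma restricted_simps [simp]:
  "restricted K (Eq s t) \<longleftrightarrow> formula K (Eq s t)"
  "restricted K (Rel r ts) \<longleftrightarrow> formula K (Rel r ts)"
  "restricted K (Neg \<phi>) \<longleftrightarrow> restricted K \<phi>"
  "restricted K (And \<phi> \<psi>) \<longleftrightarrow> restricted K \<phi> \<and> restricted K \<psi>"
  "restricted K (Forall v \<phi>) \<longleftrightarrow> restricted K \<phi>"
  "restricted K (Bar \<phi> \<psi>) \<longleftrightarrow> basic K \<phi> \<and> basic K \<psi>"
  by (subst restricted.simps; auto intro: restricted.intros basic.intros)+

lemma wf_tm_subst:
  "wf_tm K t \<Longrightarrow> \<forall>u. wf_tm K (\<sigma> u) \<Longrightarrow> wf_tm K (subst_tm \<sigma> t)"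
  by (induction t) auto

lemma formula_subst:
  "formula K \<phi> \<Longrightarrow> \<forall>u. wf_tm K (\<sigma> u) \<Longrightarrow> formula K (subst \<sigma> \<phi>)"
  by (induction \<phi> arbitrary: \<sigma>) (auto intro: wf_tm_subst)

lemma basic_subst:
  "basic K \<phi> \<Longrightarrow> \<forall>u. wf_tm K (\<sigma> u) \<Longrightarrow> basic K (subst \<sigma> \<phi>)"
  by (induction \<phi> arbitrary: \<sigma>) (auto intro: wf_tm_subst formula_subst)

lemma restricted_subst:
  "restricted K \<phi> \<Longrightarrow> \<forall>u. wf_tm K (\<sigma> u) \<Longrightarrow> restricted K (subst \<sigma> \<phi>)"
  by (induction \<phi> arbitrary: \<sigma>) (auto intro: wf_tm_subst basic_subst)

lemma wf_tm_embed: "wf_tm L t \<Longrightarrow> wf_tm (lang_of L M) (map_tm Symb t)"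
  by (induction t) (auto simp: lang_of_def)

lemma formula_embed: "formula L \<phi> \<Longrightarrow> formula (lang_of L M) (embed \<phi>)"
proof (induction \<phi>)
  case (Rel r ts)
  then have "rel_ar (lang_of L M) r = Some (length ts)" by (simp add: lang_of_def)
  with Rel show ?case by (auto intro: wf_tm_embed)
qed (auto intro: wf_tm_embed)

lemma basic_embed: "basic L \<phi> \<Longrightarrow> basic (lang_of L M) (embed \<phi>)"
  by (induction rule: basic.induct) (auto intro: formula_embed basic.intros(1))

lemma restricted_embed: "restricted L \<phi> \<Longrightarrow> restricted (lang_of L M) (embed \<phi>)"
  by (induction rule: restricted.induct) (auto intro: basic_embed restricted.intros(1))

lemma fun_ar_Name [simp]: "fun_ar (lang_of L M) (Name x) = Some 0 \<longleftrightarrow> x \<in> Dom M"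
  by (simp add: lang_of_def)

lemma wf_tm_substD: "wf_tm K (subst_tm \<sigma> t) \<Longrightarrow> v \<in> fv_tm t \<Longrightarrow> wf_tm K (\<sigma> v)"
  by (induction t) auto

lemma formula_substD: "formula K (subst \<sigma> \<phi>) \<Longrightarrow> v \<in> fv \<phi> \<Longrightarrow> wf_tm K (\<sigma> v)"
  by (induction \<phi> arbitrary: \<sigma>) (fastforce dest: wf_tm_substD)+

lemma basic_substD: "basic K (subst \<sigma> \<phi>) \<Longrightarrow> v \<in> fv \<phi> \<Longrightarrow> wf_tm K (\<sigma> v)"
  by (induction \<phi> arbitrary: \<sigma>) (fastforce dest: wf_tm_substD formula_substD)+

text \<open>Needed for universal instantiation: the scheme \<open>UI\<close> does not ask that its
  closed term be a term of the language, so this is recovered from the restrictedness of the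
  instance.\<close>

lemma restricted_substD: "restricted K (subst \<sigma> \<phi>) \<Longrightarrow> v \<in> fv \<phi> \<Longrightarrow> wf_tm K (\<sigma> v)"
  by (induction \<phi> arbitrary: \<sigma>) (fastforce dest: wf_tm_substD basic_substD)+


section \<open>Composition of substitutions\<close>

lemma subst_tm_cong: "\<forall>u\<in>fv_tm t. \<sigma> u = \<tau> u \<Longrightarrow> subst_tm \<sigma> t = subst_tm \<tau> t"
  by (induction t) auto

lemma subst_cong: "\<forall>u\<in>fv \<phi>. \<sigma> u = \<tau> u \<Longrightarrow> subst \<sigma> \<phi> = subst \<tau> \<phi>"
proof (induction \<phi> arbitrary: \<sigma> \<tau>)
  case (Forall v \<phi>)
  then have "subst (\<sigma>(v := Var v)) \<phi> = subst (\<tau>(v := Var v)) \<phi>" by (intro Forall.IH) auto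
  then show ?case by simp
qed (auto intro: subst_tm_cong)

lemma subst_tm_closed: "fv_tm t = {} \<Longrightarrow> subst_tm \<sigma> t = t"
  by (simp add: subst_tm_id)

lemma subst_tm_subst_tm: "subst_tm \<tau> (subst_tm \<sigma> t) = subst_tm (\<lambda>u. subst_tm \<tau> (\<sigma> u)) t"
  by (induction t) auto

text \<open>Bound variables are never renamed. Substitutions that keep a variable or replace it by a
  closed term cannot cause capture, and this property survives the reset of a variable at a
  quantifier.\<close>

definition closing :: "(nat \<Rightarrow> 'f tm) \<Rightarrow> bool" where
  "closing \<sigma> \<longleftrightarrow> (\<forall>u. \<sigma> u = Var u \<or> fv_tm (\<sigma> u) = {})"

lemma closing_upd [simp]: "closing \<sigma> \<Longrightarrow> closing (\<sigma>(v := Var v))"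
  by (simp add: closing_def)

lemma closing_name [simp]: "closing (\<lambda>v. name (e v))"
  by (simp add: closing_def)

lemma closing_subst1 [simp]: "fv_tm t = {} \<Longrightarrow> closing (Var(v := t))"
  by (simp add: closing_def)

lemma fv_tm_subst_tm: "fv_tm (subst_tm \<sigma> t) = (\<Union>u\<in>fv_tm t. fv_tm (\<sigma> u))"
  by (induction t) auto

lemma fv_subst_closing: "closing \<sigma> \<Longrightarrow> fv (subst \<sigma> \<phi>) = (\<Union>u\<in>fv \<phi>. fv_tm (\<sigma> u))"
proof (induction \<phi> arbitrary: \<sigma>)
  case (Forall v \<phi>)
  have "fv_tm (\<sigma> u) - {v} = fv_tm (\<sigma> u)" if "u \<noteq> v" for u
    using Forall.prems that by (metis Diff_empty Diff_insert0 closing_def empty_iff fv_tm.simps(1) singletonD)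
  then have "(\<Union>u\<in>fv \<phi>. fv_tm ((\<sigma>(v := Var v)) u)) - {v} = (\<Union>u\<in>fv \<phi> - {v}. fv_tm (\<sigma> u))"
    by (auto split: if_splits)
  then show ?case
    by (simp only: subst.simps fv.simps Forall.IH[OF closing_upd[OF Forall.prems]])
qed (auto simp: fv_tm_subst_tm)

lemma subst_subst_closing:
  "closing \<sigma> \<Longrightarrow> subst \<tau> (subst \<sigma> \<phi>) = subst (\<lambda>u. subst_tm \<tau> (\<sigma> u)) \<phi>"
proof (induction \<phi> arbitrary: \<sigma> \<tau>)
  case (Forall v \<phi>)
  have "(\<lambda>u. subst_tm (\<tau>(v := Var v)) ((\<sigma>(v := Var v)) u)) = (\<lambda>u. subst_tm \<tau> (\<sigma> u))(v := Var v)"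
  proof
    fix u
    have "\<sigma> u = Var u \<or> fv_tm (\<sigma> u) = {}" using Forall.prems by (simp add: closing_def)
    then show "subst_tm (\<tau>(v := Var v)) ((\<sigma>(v := Var v)) u) = ((\<lambda>u. subst_tm \<tau> (\<sigma> u))(v := Var v)) u"
      by (auto simp: subst_tm_closed)
  qed
  then show ?case by (simp only: subst.simps Forall.IH[OF closing_upd[OF Forall.prems]])
qed (auto simp: subst_tm_subst_tm)

lemma subst_subst1_free_for:
  "free_for t v \<phi> \<Longrightarrow> subst \<tau> (subst1 v t \<phi>) = subst (\<tau>(v := subst_tm \<tau> t)) \<phi>"
proof (induction \<phi> arbitrary: \<tau>)
  case (Forall w \<phi>)
  \<comment> \<open>The case \<open>w = v\<close> falls under the first alternative, where neither
    side touches \<open>v\<close>. In the second, the reset of \<open>w\<close> commutes with the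
    update at \<open>v\<close>.\<close>
  consider "v \<notin> fv (Forall w \<phi>)" | "w \<noteq> v" "w \<notin> fv_tm t" "free_for t v \<phi>"
    using Forall.prems by fastforce
  then show ?case
  proof cases
    case 1
    then have "subst1 v t (Forall w \<phi>) = Forall w \<phi>" by (intro subst_id) auto
    moreover have "subst (\<tau>(v := subst_tm \<tau> t)) (Forall w \<phi>) = subst \<tau> (Forall w \<phi>)"
      using 1 by (intro subst_cong) auto
    ultimately show ?thesis by (simp only:)
  next
    case 2
    have "subst_tm (\<tau>(w := Var w)) t = subst_tm \<tau> t" using 2 by (intro subst_tm_cong) auto
    moreover have "(Var(v := t))(w := Var w) = Var(v := t)" using 2 by auto
    ultimately show ?thesis
      using Forall.IH[OF 2(3), of "\<tau>(w := Var w)"] fun_upd_twist[OF 2(1), of \<tau> "Var w" "subst_tm \<tau> t"]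
      by (simp only: subst.simps)
  qed
qed (auto simp: subst_tm_subst_tm intro!: subst_tm_cong)

lemma free_for_closed: "fv_tm t = {} \<Longrightarrow> free_for t v \<phi>"
  by (induction \<phi>) auto

lemma embed_subst_tm:
  "map_tm Symb (subst_tm \<sigma> t) = subst_tm (\<lambda>u. map_tm Symb (\<sigma> u)) (map_tm Symb t)"
  by (induction t) auto

lemma embed_subst: "embed (subst \<sigma> \<phi>) = subst (\<lambda>u. map_tm Symb (\<sigma> u)) (embed \<phi>)"
proof (induction \<phi> arbitrary: \<sigma>)
  case (Forall v \<phi>)
  then show ?case
    by (simp only: subst.simps fm.map fm.inject simp_thms) (rule subst_cong, simp)
qed (auto simp: embed_subst_tm)

lemma embed_subst1: "embed (subst1 v t \<phi>) = subst1 v (map_tm Symb t) (embed \<phi>)"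
  unfolding embed_subst by (rule subst_cong) simp

lemma free_for_embed: "free_for (map_tm Symb t) v (embed \<phi>) = free_for t v \<phi>"
  by (induction \<phi>) auto


section \<open>Soundness of the rules\<close>

abbreviation inst :: "(nat \<Rightarrow> 'm) \<Rightarrow> ('f, 'r) fm \<Rightarrow> ('f, 'r, 'm) efm" where
  "inst e \<phi> \<equiv> subst (\<lambda>v. name (e v)) (embed \<phi>)"

text \<open>Turns the quantifier clause, which substitutes names, into an update of the assignment:
  the inner substitution is closing, so the substitution of a name composes with it.\<close>

lemma truth_inst_Forall:
  "truth M f (inst e (Forall v \<phi>)) \<longleftrightarrow> (\<forall>x\<in>Dom M. truth M f (inst (e(v := x)) \<phi>))"
proof -
  have "subst1 v (name x) (subst ((\<lambda>v. name (e v))(v := Var v)) (embed \<phi>)) = inst (e(v := x)) \<phi>" for x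
    by (subst subst_subst_closing) (auto intro!: subst_cong)
  then show ?thesis by simp
qed

lemma inst_irrelevant: "v \<notin> fv \<phi> \<Longrightarrow> inst (e(v := x)) \<phi> = inst e \<phi>"
  by (intro subst_cong) auto

lemma models_MP: "models M f \<phi> \<Longrightarrow> models M f (Imp \<phi> \<psi>) \<Longrightarrow> models M f \<psi>"
  by (auto simp: models_def)

text \<open>\<open>models\<close> ranges over all assignments into the domain, hence also over the
  updated ones that the quantifier clause asks for.\<close>

lemma models_GR:
  assumes "models M f \<phi>"
  shows "models M f (Forall v \<phi>)"
proof -
  have "truth M f (inst (e(v := x)) \<phi>)" if "range e \<subseteq> Dom M" "x \<in> Dom M" for e x
  proof -
    have "range (e(v := x)) \<subseteq> Dom M" using that by auto
    with assms show ?thesis by (simp only: models_def)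
  qed
  then show ?thesis unfolding models_def truth_inst_Forall by blast
qed

lemma provable_models:
  assumes "provable L \<Lambda> \<Sigma> \<phi>" "IR \<Lambda> = {MP, GR}"
    and "\<And>\<psi>. \<psi> \<in> Ax \<Lambda> \<Longrightarrow> models M f \<psi>" "\<And>\<psi>. \<psi> \<in> \<Sigma> \<Longrightarrow> models M f \<psi>"
  shows "models M f \<phi>"
  using assms(1)
proof induction
  case (3 R ps \<phi>)
  then consider \<psi> where "ps = [\<psi>, Imp \<psi> \<phi>]" | \<psi> v where "ps = [\<psi>]" "\<phi> = Forall v \<psi>"
    using assms(2) by (auto simp: MP_def GR_def)
  then show ?case
  proof cases
    case 1
    then have "models M f \<psi>" "models M f (Imp \<psi> \<phi>)" using 3 by simp_all
    then show ?thesis by (rule models_MP)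
  next
    case 2
    then have "models M f \<psi>" using 3 by simp
    with 2 show ?thesis by (simp only: models_GR)
  qed
qed (use assms in blast)+

lemma sound_MP_GR:
  assumes "Ax \<Lambda> \<subseteq> Taut L X" "IR \<Lambda> = {MP, GR}"
  shows "sound L X \<Lambda>"
proof -
  have "models M f \<psi>" if "(M, f) \<in> X" "\<psi> \<in> Ax \<Lambda>" for M f \<psi>
    using assms(1) that by (auto simp: Taut_def entails_def)
  then show ?thesis
    unfolding sound_def entails_def using provable_models[OF _ assms(2)] by blast
qed


section \<open>Evaluation of closed terms\<close>

lemma fv_tm_eval_closed_tm [simp]: "fv_tm (eval_closed_tm M t) = fv_tm t"
  by (induction t) auto

lemma fv_eval_closed [simp]: "fv (eval_closed M \<phi>) = fv \<phi>"
  by (induction \<phi>) auto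

lemma eval_closed_tm_closed: "fv_tm t = {} \<Longrightarrow> eval_closed_tm M t = name (val M t)"
  by (cases t) auto

text \<open>Variables are kept, with the default value \<open>undefined\<close> on both sides, and a
  closed subterm becomes a name whose value is the one it had.\<close>

lemma val_eval_closed_tm [simp]: "val M (eval_closed_tm M t) = val M t"
proof (induction t)
  case (Fun s ts)
  then have "map (val M) (map (eval_closed_tm M) ts) = map (val M) ts" by simp
  then show ?case
    by (simp only: eval_closed_tm.simps val.simps esym_int.simps if_distrib[of "val M"] if_cancel)
qed simp

lemma val_cong: "eval_closed_tm M s = eval_closed_tm M t \<Longrightarrow> val M s = val M t"
  by (metis val_eval_closed_tm)

lemma eval_closed_tm_idem [simp]: "eval_closed_tm M (eval_closed_tm M t) = eval_closed_tm M t"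
proof (induction t)
  case (Fun s ts)
  then have "map (eval_closed_tm M) (map (eval_closed_tm M) ts) = map (eval_closed_tm M) ts" by simp
  then show ?case by (cases "fv_tm (Fun s ts) = {}") (auto simp del: map_map)
qed simp

text \<open>Substitution can create new closed subterms, which is why the right-hand side evaluates
  once more on the outside.\<close>

lemma eval_closed_tm_subst:
  "eval_closed_tm M (subst_tm \<sigma> t) =
   eval_closed_tm M (subst_tm (\<lambda>u. eval_closed_tm M (\<sigma> u)) (eval_closed_tm M t))"
proof (induction t)
  case (Var v)
  show ?case by simp
next
  case (Fun s ts)
  let ?\<tau> = "\<lambda>u. eval_closed_tm M (\<sigma> u)"
  show ?case
  proof (cases "fv_tm (Fun s ts) = {}")
    case True
    then show ?thesis
      by (simp only: subst_tm_closed eval_closed_tm_idem fv_tm_eval_closed_tm)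
  next
    case False
    \<comment> \<open>The substituted term may be closed or still open. Equal free variables put
      both sides into the same branch of \<open>eval_closed_tm\<close>; equal values of the
      arguments settle the closed branch, equal evaluated arguments the open one.\<close>
    have fv_eq: "fv_tm (subst_tm \<sigma> t) = fv_tm (subst_tm ?\<tau> (eval_closed_tm M t))" for t
      by (simp add: fv_tm_subst_tm)
    have "map (val M) (map (subst_tm \<sigma>) ts) =
        map (val M) (map (subst_tm ?\<tau>) (map (eval_closed_tm M) ts))"
      using val_cong[OF Fun.IH] by simp
    moreover have "map (eval_closed_tm M) (map (subst_tm \<sigma>) ts) =
        map (eval_closed_tm M) (map (subst_tm ?\<tau>) (map (eval_closed_tm M) ts))"
      using Fun.IH by simp
    moreover have "fv_tm (Fun s (map (subst_tm \<sigma>) ts)) =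
        fv_tm (Fun s (map (subst_tm ?\<tau>) (map (eval_closed_tm M) ts)))"
      using fv_eq by simp
    ultimately show ?thesis
      using False by (simp only: subst_tm.simps eval_closed_tm.simps val.simps if_False)
  qed
qed

lemma eval_closed_subst:
  "eval_closed M (subst \<sigma> \<phi>) =
   eval_closed M (subst (\<lambda>u. eval_closed_tm M (\<sigma> u)) (eval_closed M \<phi>))"
proof (induction \<phi> arbitrary: \<sigma>)
  case (Forall v \<phi>)
  have "(\<lambda>u. eval_closed_tm M ((\<sigma>(v := Var v)) u)) = (\<lambda>u. eval_closed_tm M (\<sigma> u))(v := Var v)"
    by auto
  with Forall[of "\<sigma>(v := Var v)"] show ?case by (simp only: subst.simps eval_closed.simps)
qed (auto intro: eval_closed_tm_subst)

text \<open>Serves the quantifier cases below and the comparison of instances by different closed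
  terms of the same value.\<close>

lemma eval_closed_subst_cong:
  assumes "eval_closed M \<alpha> = eval_closed M \<beta>"
    and "\<And>u. eval_closed_tm M (\<sigma> u) = eval_closed_tm M (\<tau> u)"
  shows "eval_closed M (subst \<sigma> \<alpha>) = eval_closed M (subst \<tau> \<beta>)"
  using assms by (simp add: eval_closed_subst[of M \<sigma>] eval_closed_subst[of M \<tau>])

lemma val_subst_cong:
  assumes "\<And>u. eval_closed_tm M (\<sigma> u) = eval_closed_tm M (\<tau> u)"
  shows "val M (subst_tm \<sigma> t) = val M (subst_tm \<tau> t)"
  using assms by (intro val_cong)
    (simp_all add: eval_closed_tm_subst[of M \<sigma>] eval_closed_tm_subst[of M \<tau>])

text \<open>Evaluation keeps the connectives, so \<beta> can be decomposed along with \<alpha>. At a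
  quantifier, instances by the same name again have equal evaluated forms.\<close>

lemma holds_cong:
  "eval_closed M \<alpha> = eval_closed M \<beta> \<Longrightarrow> holds M \<alpha> = holds M \<beta>"
proof (induction M \<alpha> arbitrary: \<beta> rule: holds.induct)
  case (1 M s t)
  then obtain s' t' where "\<beta> = Eq s' t'" by (cases \<beta>) auto
  with 1 val_cong[of M s s'] val_cong[of M t t'] show ?case by simp
next
  case (2 M r ts)
  then obtain ts' where ts': "\<beta> = Rel r ts'" by (cases \<beta>) auto
  with 2 have eq: "map (eval_closed_tm M) ts = map (eval_closed_tm M) ts'" by simp
  have "map (val M) (map (eval_closed_tm M) us) = map (val M) us" for us by simp
  with eq have "map (val M) ts = map (val M) ts'" by metis
  with ts' show ?case by simp
next
  case (3 M \<phi>)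
  then obtain \<phi>' where \<beta>: "\<beta> = Neg \<phi>'" by (cases \<beta>) auto
  with 3 have "holds M \<phi> = holds M \<phi>'" by (intro 3(1)) simp_all
  with \<beta> show ?case by simp
next
  case (4 M \<phi> \<psi>)
  then obtain \<phi>' \<psi>' where \<beta>: "\<beta> = And \<phi>' \<psi>'" by (cases \<beta>) auto
  with 4 have "holds M \<phi> = holds M \<phi>'" by (intro 4(1)) simp_all
  moreover from 4 \<beta> have "holds M \<psi> = holds M \<psi>'" by (intro 4(2)) simp_all
  ultimately show ?case using \<beta> by simp
next
  case (5 M v \<phi>)
  then obtain \<psi> where \<psi>: "\<beta> = Forall v \<psi>" "eval_closed M \<phi> = eval_closed M \<psi>" by (cases \<beta>) auto
  then have "holds M (subst1 v (name x) \<phi>) = holds M (subst1 v (name x) \<psi>)" if "x \<in> Dom M" for x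
    using that 5 by (intro 5(1) eval_closed_subst_cong) auto
  with \<psi> show ?case by simp
next
  case (6 M \<phi> \<psi>)
  then show ?case by (cases \<beta>) auto
qed


section \<open>Truth depends only on the evaluated sentence\<close>

text \<open>A choice function is constrained on sentences only. The induction supplies sentences as
  its arguments, and it returns one of them.\<close>

lemma collapse_sentence:
  assumes "choice_fun L M f" "basic (lang_of L M) \<phi>" "fv \<phi> = {}"
  shows "sentence (lang_of L M) (collapse f \<phi>)"
  using assms(2,3)
proof (induction \<phi> rule: fm.induct)
  case (Bar \<phi> \<psi>)
  then have "f (Upair (collapse f \<phi>) (collapse f \<psi>)) \<in> {collapse f \<phi>, collapse f \<psi>}"
    using assms(1) by (simp add: choice_fun_def)
  with Bar show ?case by auto
qed (auto simp: sentence_def)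

text \<open>Within a basic formula a quantifier stands only before a formula of \<open>L(M)\<close>,
  where \<open>truth\<close> is \<open>holds\<close> and the collapse changes nothing.\<close>

lemma truth_basic:
  "basic (lang_of L M) \<phi> \<Longrightarrow> truth M f \<phi> = holds M (collapse f \<phi>)"
proof (induction \<phi>)
  case (Forall v \<phi>)
  then show ?case using truth_formula[of L M "Forall v \<phi>" f] by (simp only: basic_simps formula.simps collapse.simps)
qed auto

text \<open>Here the condition that separates \<open>ident_choice\<close> from
  \<open>all_choice\<close> enters: at a superposition it carries equality of evaluated forms from
  the arguments to the chosen sentences.\<close>

lemma collapse_cong:
  assumes f: "(M, f) \<in> ident_choice L"
    and "basic (lang_of L M) \<alpha>" "basic (lang_of L M) \<beta>" "fv \<alpha> = {}" "eval_closed M \<alpha> = eval_closed M \<beta>"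
  shows "eval_closed M (collapse f \<alpha>) = eval_closed M (collapse f \<beta>)"
  using assms(2-)
proof (induction \<alpha> arbitrary: \<beta> rule: fm.induct)
  case (Neg \<phi>)
  then obtain \<phi>' where \<beta>: "\<beta> = Neg \<phi>'" by (cases \<beta>) auto
  with Neg.prems have "eval_closed M (collapse f \<phi>) = eval_closed M (collapse f \<phi>')"
    by (intro Neg.IH) simp_all
  with \<beta> show ?case by simp
next
  case (And \<phi> \<psi>)
  then obtain \<phi>' \<psi>' where \<beta>: "\<beta> = And \<phi>' \<psi>'" by (cases \<beta>) auto
  with And.prems have "eval_closed M (collapse f \<phi>) = eval_closed M (collapse f \<phi>')"
    by (intro And.IH) simp_all
  moreover from And.prems \<beta> have "eval_closed M (collapse f \<psi>) = eval_closed M (collapse f \<psi>')"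
    by (intro And.IH) simp_all
  ultimately show ?case using \<beta> by simp
next
  case (Bar \<phi> \<psi>)
  then obtain \<phi>' \<psi>' where \<beta>: "\<beta> = Bar \<phi>' \<psi>'"
    and ev: "eval_closed M \<phi> = eval_closed M \<phi>'" "eval_closed M \<psi> = eval_closed M \<psi>'"
    by (cases \<beta>) auto
  have "eval_closed M (collapse f \<phi>) = eval_closed M (collapse f \<phi>')"
    using Bar.prems \<beta> ev by (intro Bar.IH) simp_all
  moreover have "eval_closed M (collapse f \<psi>) = eval_closed M (collapse f \<psi>')"
    using Bar.prems \<beta> ev by (intro Bar.IH) simp_all
  \<comment> \<open>Evaluation preserves free variables, so the operands of \<beta> are closed as
    well and all four collapses are sentences.\<close>
  moreover have "fv \<phi>' = {}" "fv \<psi>' = {}"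
    using Bar.prems ev fv_eval_closed by (metis Un_empty fv.simps(6))+
  then have "sentence (lang_of L M) (collapse f \<chi>)" if "\<chi> \<in> {\<phi>, \<psi>, \<phi>', \<psi>'}" for \<chi>
    using that Bar.prems \<beta> f
    by (intro collapse_sentence) (auto simp: ident_choice_def all_choice_def)
  ultimately show ?case
    using f \<beta> by (simp add: ident_choice_def same_sentence_def)
qed (case_tac \<beta>; simp)+

lemma fv_subst1_closed: "fv (Forall v \<phi>) = {} \<Longrightarrow> fv (subst1 v (name x) \<phi>) = {}"
  by (auto simp: fv_subst_closing split: if_splits)

text \<open>This makes it harmless to exchange a closed term for the name of its value. A
  superposition is reduced to \<open>holds\<close> through its collapse; the other connectives go as
  in \<open>holds_cong\<close>.\<close>

lemma truth_cong:
  assumes f: "(M, f) \<in> ident_choice L"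
    and "restricted (lang_of L M) \<alpha>" "restricted (lang_of L M) \<beta>" "fv \<alpha> = {}"
    and "eval_closed M \<alpha> = eval_closed M \<beta>"
  shows "truth M f \<alpha> = truth M f \<beta>"
  using assms
proof (induction M f \<alpha> arbitrary: \<beta> rule: truth.induct)
  case (1 M f s t)
  then show ?case using holds_cong[of M "Eq s t" \<beta>] by (cases \<beta>) auto
next
  case (2 M f r ts)
  then show ?case using holds_cong[of M "Rel r ts" \<beta>] by (cases \<beta>) auto
next
  case (3 M f \<phi>)
  then obtain \<phi>' where \<beta>: "\<beta> = Neg \<phi>'" by (cases \<beta>) auto
  with 3 have "truth M f \<phi> = truth M f \<phi>'" by (intro 3(1)) simp_all
  with \<beta> show ?case by simp
next
  case (4 M f \<phi> \<psi>)
  then obtain \<phi>' \<psi>' where \<beta>: "\<beta> = And \<phi>' \<psi>'" by (cases \<beta>) auto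
  with 4 have "truth M f \<phi> = truth M f \<phi>'" by (intro 4(1)) simp_all
  moreover from 4 \<beta> have "truth M f \<psi> = truth M f \<psi>'" by (intro 4(2)) simp_all
  ultimately show ?case using \<beta> by simp
next
  case (5 M f \<phi> \<psi>)
  \<comment> \<open>\<beta> is a superposition too, and a restricted formula of that shape is
    basic.\<close>
  then have basic: "basic (lang_of L M) (Bar \<phi> \<psi>)" "basic (lang_of L M) \<beta>" by (cases \<beta>; simp)+
  have "eval_closed M (collapse f (Bar \<phi> \<psi>)) = eval_closed M (collapse f \<beta>)"
    using 5 basic by (intro collapse_cong) auto
  then show ?case
    using holds_cong truth_basic[OF basic(1)] truth_basic[OF basic(2)] by metis
next
  case (6 M f v \<phi>)
  then obtain \<psi> where \<psi>: "\<beta> = Forall v \<psi>" "eval_closed M \<phi> = eval_closed M \<psi>" by (cases \<beta>) auto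
  then have "truth M f (subst1 v (name x) \<phi>) = truth M f (subst1 v (name x) \<psi>)" if "x \<in> Dom M" for x
    using that 6 by (intro 6(1) eval_closed_subst_cong fv_subst1_closed restricted_subst) auto
  with \<psi> show ?case by simp
qed


section \<open>Soundness of the axioms\<close>

lemma restricted_inst:
  "restricted L \<phi> \<Longrightarrow> range e \<subseteq> Dom M \<Longrightarrow> restricted (lang_of L M) (inst e \<phi>)"
  by (intro restricted_subst restricted_embed) auto

lemma basic_inst:
  "basic L \<phi> \<Longrightarrow> range e \<subseteq> Dom M \<Longrightarrow> basic (lang_of L M) (inst e \<phi>)"
  by (intro basic_subst basic_embed) auto

lemma fv_inst [simp]: "fv (inst e \<phi>) = {}"
  by (simp add: fv_subst_closing)

abbreviation inst_tm :: "(nat \<Rightarrow> 'm) \<Rightarrow> 'f tm \<Rightarrow> ('f, 'm) esym tm" where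
  "inst_tm e t \<equiv> subst_tm (\<lambda>v. name (e v)) (map_tm Symb t)"

lemma fv_tm_inst_tm [simp]: "fv_tm (inst_tm e t) = {}"
  by (simp add: fv_tm_subst_tm)

lemma inst_subst1:
  "free_for t v \<phi> \<Longrightarrow>
    inst e (subst1 v t \<phi>) = subst ((\<lambda>v. name (e v))(v := inst_tm e t)) (embed \<phi>)"
  by (simp add: embed_subst1 subst_subst1_free_for free_for_embed)

lemma val_in_Dom:
  "is_struct L M \<Longrightarrow> wf_tm (lang_of L M) t \<Longrightarrow> fv_tm t = {} \<Longrightarrow> val M t \<in> Dom M"
proof (induction t)
  case (Fun s ts)
  then have "set (map (val M) ts) \<subseteq> Dom M" by auto
  with Fun.prems show ?case
    by (cases s) (auto simp: is_struct_def lang_of_def split: if_splits)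
qed simp

text \<open>Both sides are instances of one formula under substitutions that differ only at
  \<open>v\<close>, by closed terms with the same evaluated form.\<close>

lemma truth_inst_subst1:
  assumes f: "(M, f) \<in> ident_choice L" and e: "range e \<subseteq> Dom M"
    and "restricted L (subst1 v t \<phi>)" "restricted L (subst1 v s \<phi>)"
    and "free_for t v \<phi>" "free_for s v \<phi>" "val M (inst_tm e t) = val M (inst_tm e s)"
  shows "truth M f (inst e (subst1 v t \<phi>)) = truth M f (inst e (subst1 v s \<phi>))"
proof (rule truth_cong[OF f])
  show "eval_closed M (inst e (subst1 v t \<phi>)) = eval_closed M (inst e (subst1 v s \<phi>))"
    using assms by (simp only: inst_subst1, intro eval_closed_subst_cong)
      (simp_all add: eval_closed_tm_closed)
qed (use assms in \<open>auto intro: restricted_inst\<close>)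

lemma truth_instantiation:
  assumes f: "(M, f) \<in> ident_choice L" and e: "range e \<subseteq> Dom M"
    and r: "restricted L \<phi>" "restricted L (subst1 v t \<phi>)" and t: "fv_tm t = {}"
    and all: "truth M f (inst e (Forall v \<phi>))"
  shows "truth M f (inst e (subst1 v t \<phi>))"
proof (cases "v \<in> fv \<phi>")
  \<comment> \<open>If \<open>v\<close> is not free, \<open>t\<close> may fail to be a term of the
    language and its value may lie outside the domain. The instance is then \<phi> itself, obtained
    from the trivial update at \<open>e v\<close>.\<close>
  case False
  then have "subst1 v t \<phi> = \<phi>" by (intro subst_id) auto
  moreover have "truth M f (inst (e(v := e v)) \<phi>)"
    using all e unfolding truth_inst_Forall by blast
  ultimately show ?thesis by simp
next
  case True
  \<comment> \<open>The quantifier is instantiated at the value of \<open>t\<close>; the name of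
    this value and \<open>t\<close> have the same evaluated form.\<close>
  define x where "x = val M (inst_tm e t)"
  have "wf_tm L t" using restricted_substD[OF r(2) True] by simp
  then have "wf_tm (lang_of L M) (inst_tm e t)" using e
    by (intro wf_tm_subst wf_tm_embed) auto
  then have x: "x \<in> Dom M"
    unfolding x_def using f by (intro val_in_Dom) (auto simp: ident_choice_def all_choice_def)
  have e': "range (e(v := x)) \<subseteq> Dom M" using e x by auto
  have "truth M f (inst (e(v := x)) \<phi>) = truth M f (inst e (subst1 v t \<phi>))"
  proof (rule truth_cong[OF f])
    show "eval_closed M (inst (e(v := x)) \<phi>) = eval_closed M (inst e (subst1 v t \<phi>))"
      using t by (simp only: inst_subst1 free_for_closed, intro eval_closed_subst_cong)
        (simp_all add: eval_closed_tm_closed x_def)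
  qed (use e e' r in \<open>simp_all only: restricted_inst fv_inst\<close>)
  with all x show ?thesis unfolding truth_inst_Forall by blast
qed

text \<open>The choice function returns one of the two collapsed operands, whose truth is that of
  the operand. This yields both \<open>S1\<close> and \<open>S2\<close>.\<close>

lemma truth_Bar_cases:
  assumes "choice_fun L M f" "basic L \<phi>" "basic L \<psi>" "range e \<subseteq> Dom M"
  shows "truth M f (inst e (Bar \<phi> \<psi>)) \<in> {truth M f (inst e \<phi>), truth M f (inst e \<psi>)}"
proof -
  have b: "basic (lang_of L M) (inst e \<phi>)" "basic (lang_of L M) (inst e \<psi>)"
    using assms by (simp_all only: basic_inst)
  have "f (Upair (collapse f (inst e \<phi>)) (collapse f (inst e \<psi>)))
      \<in> {collapse f (inst e \<phi>), collapse f (inst e \<psi>)}"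
    using assms(1) collapse_sentence[OF assms(1)] b by (simp add: choice_fun_def)
  with truth_basic[OF b(1), of f] truth_basic[OF b(2), of f] show ?thesis by auto
qed

text \<open>Choice functions act on unordered pairs.\<close>

lemma truth_Bar_commute: "truth M f (Bar \<alpha> \<beta>) = truth M f (Bar \<beta> \<alpha>)"
proof -
  have "Upair (collapse f \<alpha>) (collapse f \<beta>) = Upair (collapse f \<beta>) (collapse f \<alpha>)" by simp
  then show ?thesis by (simp only: truth.simps)
qed

lemma val_inst_subst1:
  assumes "val M (inst_tm e t) = val M (inst_tm e s)"
  shows "val M (inst_tm e (subst_tm (Var(v := t)) u)) = val M (inst_tm e (subst_tm (Var(v := s)) u))"
  unfolding embed_subst_tm subst_tm_subst_tm
  by (rule val_subst_cong) (use assms in \<open>simp_all add: eval_closed_tm_closed fv_tm_subst_tm\<close>)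

lemma truth_schemes:
  assumes f: "(M, f) \<in> ident_choice L" and e: "range e \<subseteq> Dom M"
    and "\<phi> \<in> schemes" "restricted L \<phi>"
  shows "truth M f (inst e \<phi>)"
proof -
  have cf: "choice_fun L M f" using f by (simp add: ident_choice_def all_choice_def)
  show ?thesis using assms(3,4)
  proof cases
    case (UI t v \<psi>)
    with assms(4) truth_instantiation[OF f e, of \<psi> v t] show ?thesis by auto
  next
    case (D v \<psi> \<chi>)
    \<comment> \<open>As \<open>v\<close> is not free in \<psi>, the premise keeps its truth value
      while the quantifier moves \<open>v\<close>.\<close>
    have *: "truth M f (inst (e(v := x)) \<psi>) = truth M f (inst e \<psi>)" for x
      using inst_irrelevant[OF D(2)] by metis
    have "truth M f (inst e (Forall v (Imp \<psi> \<chi>))) \<Longrightarrow> truth M f (inst e \<psi>) \<Longrightarrow>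
        truth M f (inst e (Forall v \<chi>))"
      unfolding truth_inst_Forall using * by simp
    then show ?thesis by (auto simp: D(1))
  next
    case (E_term t s v u)
    with val_inst_subst1[of M e t s v u] show ?thesis by simp
  next
    case (E_fm t v \<psi> s)
    with assms(4) truth_inst_subst1[OF f e, of v t \<psi> s] show ?thesis by auto
  next
    case (S1 \<psi> \<chi>)
    with assms(4) truth_Bar_cases[OF cf _ _ e, of \<psi> \<chi>] show ?thesis by auto
  next
    case (S2 \<psi> \<chi>)
    with assms(4) truth_Bar_cases[OF cf _ _ e, of \<psi> \<chi>] show ?thesis by auto
  next
    case (S3 \<psi> \<chi>)
    with truth_Bar_commute[of M f "inst e \<psi>" "inst e \<chi>"] show ?thesis
      by (simp del: truth.simps(5))
  \<comment> \<open>The propositional schemes and the first three equality schemes follow from the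
    truth clauses directly.\<close>
  qed auto
qed

lemma Lambda0_Taut: "Ax (Lambda0 L) \<subseteq> Taut L (ident_choice L)"
  by (auto simp: Lambda0_def Taut_def entails_def models_def intro: truth_schemes)

text \<open>By \<open>Lambda0_not_sound\<close>, a constant in the language already destroys
  soundness of \<open>Lambda0\<close> over all choice functions. Hence the restriction to
  \<open>ident_choice\<close>, which is no restriction for languages without function
  symbols.\<close>

theorem theorem5p4:
  fixes L :: "('f, 'r) language"
  shows
    "(\<forall>(X :: (('f, 'r, 'm) fo_struct \<times> ('f, 'r, 'm) choice) set) \<Lambda>.
        X \<subseteq> all_choice L \<and> Ax \<Lambda> \<subseteq> Taut L X \<and> IR \<Lambda> = {MP, GR} \<longrightarrow> sound L X \<Lambda>) \<and>
     sound L (ident_choice L :: (('f, 'r, 'm) fo_struct \<times> ('f, 'r, 'm) choice) set) (Lambda0 L) \<and>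
     ((\<forall>g. fun_ar L g = None) \<longrightarrow>
        sound L (all_choice L :: (('f, 'r, 'm) fo_struct \<times> ('f, 'r, 'm) choice) set) (Lambda0 L))"
proof -
  have "sound L (ident_choice L :: (('f, 'r, 'm) fo_struct \<times> ('f, 'r, 'm) choice) set) (Lambda0 L)"
    by (rule sound_MP_GR[OF Lambda0_Taut]) (simp add: Lambda0_def)
  then show ?thesis by (auto intro: sound_MP_GR simp: ident_choice_relational)
qed

end
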